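(* Let $\lambda>1$, $0<\epsilon<1$ and $0<\delta<1$ be real numbers, and let $\mathcal{R}\subseteq[0,2\pi)$ be the resonant set associated with $\lambda,\epsilon,\delta$ (defined in the context). For each $\alpha\in\mathbb{N}=\{1,2,3,\dots\}$ let $$S_{\alpha}=\Big\{\theta\in[0,2\pi)\ :\ |\cos(\alpha\theta)|<\lambda^{-\frac{(1-\delta)\alpha}{\epsilon}-1}\Big\},\qquad \tilde S_{\alpha}=\Big\{\theta\in[0,2\pi)\ :\ |\cos(\alpha\theta)|<\lambda^{-\frac{(1-\delta)\alpha}{\epsilon}}\Big\}.$$ Then $$\bigcup_{\alpha\in\mathbb{N}}S_\alpha\ \subseteq\ \mathcal{R}\ \subseteq\ \bigcup_{\alpha\in\mathbb{N}}\tilde S_\alpha .$$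
   Context: Fix real numbers $\lambda>1$, $0<\epsilon<1$, $0<\delta<1$. Let $$h=\begin{pmatrix}\lambda&0\\0&0\end{pmatrix},\qquad R_\theta=\begin{pmatrix}\cos\theta&-\sin\theta\\ \sin\theta&\cos\theta\end{pmatrix},\quad \theta\in[0,2\pi).$$ For $n\in\mathbb{N}=\{1,2,\dots\}$, a word $W_n$ assigns to $\theta$ a matrix $W_n(\theta)$ that is a product, in some order depending only on the word and not on $\theta$, of exactly $n$ copies of $h$ and $m$ copies of $R_\theta$, where $m$ is an integer with $0\le m\le[\epsilon n]$ ($[\cdot]$ denotes the integer part). That is, $W_n(\theta)=h^{i_1}R_\theta^{j_1}\cdots h^{i_k}R_\theta^{j_k}$ for some $k$ and nonnegative integers $i_1,\dots,i_k,j_1,\dots,j_k$ with $i_1+\dots+i_k=n$ and $j_1+\dots+j_k=m\le[\epsilon n]$. For each $n$ there are finitely many words. The norm of a $2\times2$ real matrix is the sum of the absolute values of its four entries. Set $f_n(\theta)=\min_{W_n}\|W_n(\theta)\|$, the minimum being over all words $W_n$ with exactly $n$ copies of $h$ and $m$ copies of $R_\theta$, for all integers $m$ with $0\le m\le[\epsilon n]$ and all orders of the factors. The resonant set is $$\mathcal{R}=\{\theta\in[0,2\pi)\ :\ \text{there exists } n\in\mathbb{N}\text{ with } f_n(\theta)<\lambda^{\delta n}\}.$$ *)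

theory Defs
  imports "HOL-Analysis.Analysis"
begin

definition h_mat :: "real \<Rightarrow> real^2^2" where
  "h_mat lam = vector [vector [lam, 0], vector [0, 0]]"

definition rot_mat :: "real \<Rightarrow> real^2^2" where
  "rot_mat \<theta> = vector [vector [cos \<theta>, - sin \<theta>], vector [sin \<theta>, cos \<theta>]]"

text \<open>The library norm on matrices is Euclidean; here the sum of the absolute values of the
  entries is used instead.\<close>

definition entry_norm :: "real^2^2 \<Rightarrow> real" where
  "entry_norm A = (\<Sum>i\<in>UNIV. \<Sum>j\<in>UNIV. \<bar>A $ i $ j\<bar>)"

datatype letter = H | R

type_synonym word = "letter list"

fun letter_mat :: "real \<Rightarrow> real \<Rightarrow> letter \<Rightarrow> real^2^2" where
  "letter_mat lam \<theta> H = h_mat lam"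
| "letter_mat lam \<theta> R = rot_mat \<theta>"

fun word_mat :: "real \<Rightarrow> real \<Rightarrow> word \<Rightarrow> real^2^2" where
  "word_mat lam \<theta> [] = mat 1"
| "word_mat lam \<theta> (x # w) = letter_mat lam \<theta> x ** word_mat lam \<theta> w"

definition words :: "real \<Rightarrow> nat \<Rightarrow> word set" where
  "words \<epsilon> n = {w. count_list w H = n \<and> int (count_list w R) \<le> \<lfloor>\<epsilon> * real n\<rfloor>}"

text \<open>The operator \<open>Min\<close> is only meaningful on finite nonempty sets; see
  \<open>finite_words\<close> and \<open>words_nonempty\<close> below.\<close>

definition min_word_norm :: "real \<Rightarrow> real \<Rightarrow> nat \<Rightarrow> real \<Rightarrow> real" where
  "min_word_norm lam \<epsilon> n \<theta> = Min ((\<lambda>w. entry_norm (word_mat lam \<theta> w)) ` words \<epsilon> n)"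

definition resonant_set :: "real \<Rightarrow> real \<Rightarrow> real \<Rightarrow> real set" where
  "resonant_set lam \<epsilon> \<delta> =
    {\<theta> \<in> {0..<2 * pi}. \<exists>n\<ge>1. min_word_norm lam \<epsilon> n \<theta> < lam powr (\<delta> * real n)}"

definition inner_set :: "real \<Rightarrow> real \<Rightarrow> real \<Rightarrow> nat \<Rightarrow> real set" where
  "inner_set lam \<epsilon> \<delta> \<alpha> =
    {\<theta> \<in> {0..<2 * pi}. \<bar>cos (real \<alpha> * \<theta>)\<bar> < lam powr (- ((1 - \<delta>) * real \<alpha> / \<epsilon>) - 1)}"

definition outer_set :: "real \<Rightarrow> real \<Rightarrow> real \<Rightarrow> nat \<Rightarrow> real set" where
  "outer_set lam \<epsilon> \<delta> \<alpha> =
    {\<theta> \<in> {0..<2 * pi}. \<bar>cos (real \<alpha> * \<theta>)\<bar> < lam powr (- ((1 - \<delta>) * real \<alpha> / \<epsilon>))}"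

lemma length_word: "length w = count_list w H + count_list w R"
proof (induction w)
  case (Cons x w)
  then show ?case by (cases x) simp_all
qed simp

lemma finite_words: "finite (words \<epsilon> n)"
proof (rule finite_subset)
  have "UNIV = {H, R}" using letter.exhaust by blast
  then have "finite (UNIV :: letter set)" by (metis finite.emptyI finite_insert)
  then show "finite {w. set w \<subseteq> (UNIV :: letter set) \<and> length w \<le> n + nat \<lfloor>\<epsilon> * real n\<rfloor>}"
    by (rule finite_lists_length_le)
qed (auto simp: words_def length_word)

lemma words_nonempty:
  assumes "\<epsilon> > 0"
  shows "words \<epsilon> n \<noteq> {}"
proof -
  have "count_list (replicate n H) H = n" "count_list (replicate n H) R = 0"
    by (induction n) simp_all
  then have "replicate n H \<in> words \<epsilon> n" using assms by (simp add: words_def)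
  then show ?thesis by blast
qed

end

(* Since h R_theta^j h = lambda^2 cos(j theta) E with E the matrix unit at (1,1), a word with n >= 1
   letters h has the form c R_theta^a E R_theta^b, where |c| is lambda^n times the product of the
   |cos(j theta)| over the n - 1 gaps j between consecutive letters h, and R_theta^a E R_theta^b has
   norm at least 1.  If every |cos(j theta)| is at least lambda^(-(1-delta)j/epsilon), then so is the
   product at least lambda^(-(1-delta)n), as the gaps add up to at most epsilon n; this gives the
   outer inclusion.  For the inner one, h R_theta^alpha h^(n-1) with n the ceiling of alpha/epsilon has
   norm lambda^n |cos(alpha theta)|, and the extra factor 1/lambda in the definition of S_alpha pays
   for the rounding. *)
theory Submission
  imports Defs
begin

lemma h_mat_nth [simp]:
  "h_mat l $ 1 $ 1 = l" "h_mat l $ 1 $ 2 = 0" "h_mat l $ 2 $ 1 = 0" "h_mat l $ 2 $ 2 = 0"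
  by (simp_all add: h_mat_def)

lemma rot_mat_nth [simp]:
  "rot_mat t $ 1 $ 1 = cos t" "rot_mat t $ 1 $ 2 = - sin t"
  "rot_mat t $ 2 $ 1 = sin t" "rot_mat t $ 2 $ 2 = cos t"
  by (simp_all add: rot_mat_def)

lemma matrix_mult_nth_2: "((A :: real^2^2) ** B) $ i $ j = A $ i $ 1 * B $ 1 $ j + A $ i $ 2 * B $ 2 $ j"
  by (simp add: matrix_matrix_mult_def sum_2)

lemma entry_norm_eq: "entry_norm A = \<bar>A $ 1 $ 1\<bar> + \<bar>A $ 1 $ 2\<bar> + \<bar>A $ 2 $ 1\<bar> + \<bar>A $ 2 $ 2\<bar>"
  by (simp add: entry_norm_def sum_2)

lemma rot_mat_mult: "rot_mat s ** rot_mat t = rot_mat (s + t)"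
  by (simp add: vec_eq_iff forall_2 matrix_mult_nth_2 cos_add sin_add algebra_simps)

lemma h_mat_mult: "h_mat a ** h_mat b = h_mat (a * b)"
  by (simp add: vec_eq_iff forall_2 matrix_mult_nth_2)

lemma rot_mat_0: "rot_mat 0 = mat 1"
  by (simp add: vec_eq_iff forall_2 mat_def)

lemma word_mat_append: "word_mat l t (u @ w) = word_mat l t u ** word_mat l t w"
  by (induction u) (simp_all add: matrix_mul_assoc)

lemma word_mat_replicate_R: "word_mat l t (replicate j R) = rot_mat (real j * t)"
  by (induction j) (simp_all add: rot_mat_0 rot_mat_mult algebra_simps)

lemma word_mat_replicate_H: "word_mat l t (replicate (Suc k) H) = h_mat (l ^ Suc k)"
  by (induction k) (simp_all add: h_mat_mult)

text \<open>The witness for the inner inclusion: with \<open>H\<close> at both ends only the (1,1)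
  entry survives, and the single gap contributes one cosine.\<close>

lemma entry_norm_single_gap:
  "entry_norm (word_mat l t (H # replicate a R @ replicate (Suc k) H))
    = \<bar>l\<bar> ^ (k + 2) * \<bar>cos (real a * t)\<bar>"
  by (simp only: word_mat.simps letter_mat.simps word_mat_append word_mat_replicate_R
      word_mat_replicate_H)
    (simp add: entry_norm_eq matrix_mult_nth_2 abs_mult power_abs)

lemma word_mat_no_H:
  "count_list w H = 0 \<Longrightarrow> word_mat l t w = rot_mat (real (count_list w R) * t)"
proof (induction w)
  case (Cons x w)
  then show ?case by (cases x) (simp_all add: rot_mat_mult algebra_simps)
qed (simp add: rot_mat_0)

text \<open>Numbers of absolute value at most 1 dominate their squares. Thus rotations at either end
  of a word cannot push the norm below that of the enclosed part.\<close>

lemma abs_cos_add_abs_sin_ge_1: "1 \<le> \<bar>cos x\<bar> + \<bar>sin (x :: real)\<bar>"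
proof -
  have "(cos x)\<^sup>2 \<le> \<bar>cos x\<bar>" "(sin x)\<^sup>2 \<le> \<bar>sin x\<bar>"
    using abs_cos_le_one[of x] abs_sin_le_one[of x]
    by (metis abs_ge_zero mult_left_le power2_abs power2_eq_square)+
  then show ?thesis using sin_cos_squared_add[of x] by linarith
qed

text \<open>The word has rank one: its matrix is the column
  \<open>(cos (a t), sin (a t))\<close> times the row \<open>(p, q)\<close>, where \<open>a\<close> is the number of
  leading rotations.\<close>

lemma word_mat_rank_one:
  assumes "l > 1" "s \<ge> 0" and cos_ge: "\<And>j. l powr (- (s * real j)) \<le> \<bar>cos (real j * t)\<bar>"
    and "count_list w H \<ge> 1"
  shows "\<exists>a p q. word_mat l t w $ 1 $ 1 = cos (real a * t) * p
      \<and> word_mat l t w $ 1 $ 2 = cos (real a * t) * q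
      \<and> word_mat l t w $ 2 $ 1 = sin (real a * t) * p
      \<and> word_mat l t w $ 2 $ 2 = sin (real a * t) * q
      \<and> l powr (real (count_list w H) - s * (real (count_list w R) - real a)) \<le> \<bar>p\<bar> + \<bar>q\<bar>"
  using assms(4)
\<comment> \<open>The exponent charges \<open>s\<close> per rotation except for the \<open>a\<close>
  leading ones, which cost nothing until an \<open>H\<close> in front closes them into a
  gap.\<close>
proof (induction w)
  case Nil
  then show ?case by simp
next
  case (Cons x w)
  show ?case
  proof (cases x)
    case R
    then have "count_list w H \<ge> 1" using Cons.prems by simp
    from Cons.IH[OF this] obtain a p q where
      "word_mat l t w $ 1 $ 1 = cos (real a * t) * p"
      "word_mat l t w $ 1 $ 2 = cos (real a * t) * q"
      "word_mat l t w $ 2 $ 1 = sin (real a * t) * p"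
      "word_mat l t w $ 2 $ 2 = sin (real a * t) * q"
      "l powr (real (count_list w H) - s * (real (count_list w R) - real a)) \<le> \<bar>p\<bar> + \<bar>q\<bar>"
      by blast
    \<comment> \<open>A further rotation turns only the column; the difference of the rotation count
      and \<open>a\<close> is unchanged.\<close>
    then show ?thesis using R
      by (intro exI[of _ "Suc a"] exI[of _ p] exI[of _ q])
        (simp add: matrix_mult_nth_2 cos_add sin_add algebra_simps)
  next
    case H
    show ?thesis
    proof (cases "count_list w H = 0")
      case True
      \<comment> \<open>This is the last \<open>H\<close>: the \<open>m\<close> trailing rotations
        form no gap, and charging for them only weakens the bound.\<close>
      define m where "m = count_list w R"
      have "l powr (1 - s * real m) \<le> l powr 1"
        using assms(1,2) by (intro powr_mono) auto
      also have "\<dots> \<le> l * (\<bar>cos (real m * t)\<bar> + \<bar>sin (real m * t)\<bar>)"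
        using assms(1) abs_cos_add_abs_sin_ge_1[of "real m * t"] by simp
      finally show ?thesis using H True word_mat_no_H[OF True, of l t] assms(1)
        by (intro exI[of _ 0] exI[of _ "l * cos (real m * t)"] exI[of _ "- l * sin (real m * t)"])
          (simp add: matrix_mult_nth_2 m_def abs_mult algebra_simps)
    next
      case False
      then have "count_list w H \<ge> 1" by simp
      from Cons.IH[OF this] obtain a p q where w:
        "word_mat l t w $ 1 $ 1 = cos (real a * t) * p"
        "word_mat l t w $ 1 $ 2 = cos (real a * t) * q"
        and pq: "l powr (real (count_list w H) - s * (real (count_list w R) - real a)) \<le> \<bar>p\<bar> + \<bar>q\<bar>"
        by blast
      \<comment> \<open>The new \<open>H\<close> keeps only the first row, scaled by
        \<open>l * cos (real a * t)\<close>. The cosine pays for the \<open>a\<close> rotations now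
        enclosed, and the leading count restarts at 0.\<close>
      have "l powr (1 + real (count_list w H) - s * real (count_list w R))
          = l * (l powr (- (s * real a)) *
              l powr (real (count_list w H) - s * (real (count_list w R) - real a)))"
        using assms(1) by (simp add: powr_add[symmetric] powr_mult_base algebra_simps)
      also have "\<dots> \<le> l * (\<bar>cos (real a * t)\<bar> * (\<bar>p\<bar> + \<bar>q\<bar>))"
        using assms(1) cos_ge[of a] pq by (intro mult_left_mono mult_mono) auto
      finally show ?thesis using H w assms(1)
        by (intro exI[of _ 0] exI[of _ "l * cos (real a * t) * p"]
            exI[of _ "l * cos (real a * t) * q"])
          (simp add: matrix_mult_nth_2 abs_mult algebra_simps)
    qed
  qed
qed

text \<open>The entry norm of a column times a row is the product of their entry sums, and the
  column's sum is at least 1. Charging the leading rotations too removes \<open>a\<close> from the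
  exponent.\<close>

lemma entry_norm_word_ge:
  assumes "l > 1" "s \<ge> 0" "\<And>j. l powr (- (s * real j)) \<le> \<bar>cos (real j * t)\<bar>"
    and "count_list w H \<ge> 1"
  shows "l powr (real (count_list w H) - s * real (count_list w R)) \<le> entry_norm (word_mat l t w)"
proof -
  from word_mat_rank_one[OF assms] obtain a p q where w:
    "word_mat l t w $ 1 $ 1 = cos (real a * t) * p"
    "word_mat l t w $ 1 $ 2 = cos (real a * t) * q"
    "word_mat l t w $ 2 $ 1 = sin (real a * t) * p"
    "word_mat l t w $ 2 $ 2 = sin (real a * t) * q"
    and pq: "l powr (real (count_list w H) - s * (real (count_list w R) - real a)) \<le> \<bar>p\<bar> + \<bar>q\<bar>"
    by blast
  have "l powr (real (count_list w H) - s * real (count_list w R))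
      \<le> l powr (real (count_list w H) - s * (real (count_list w R) - real a))"
    using assms(1,2) by (intro powr_mono) (auto simp: algebra_simps)
  also have "\<dots> \<le> 1 * (\<bar>p\<bar> + \<bar>q\<bar>)" using pq by simp
  also have "\<dots> \<le> (\<bar>cos (real a * t)\<bar> + \<bar>sin (real a * t)\<bar>) * (\<bar>p\<bar> + \<bar>q\<bar>)"
    by (intro mult_right_mono abs_cos_add_abs_sin_ge_1) auto
  also have "\<dots> = entry_norm (word_mat l t w)"
    by (simp add: entry_norm_eq w abs_mult algebra_simps)
  finally show ?thesis .
qed

lemma min_word_norm_less_iff:
  assumes "\<epsilon> > 0"
  shows "min_word_norm l \<epsilon> n t < c \<longleftrightarrow> (\<exists>w\<in>words \<epsilon> n. entry_norm (word_mat l t w) < c)"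
  unfolding min_word_norm_def using finite_words words_nonempty[OF assms]
  by (subst Min_less_iff) auto

lemma count_list_replicate: "count_list (replicate k x) y = (if x = y then k else 0)"
  by (induction k) auto

lemma inner_set_subset_resonant_set:
  assumes "l > 1" "0 < \<epsilon>" "\<epsilon> < 1" "0 < \<delta>" "\<delta> < 1" "\<alpha> \<ge> 1"
  shows "inner_set l \<epsilon> \<delta> \<alpha> \<subseteq> resonant_set l \<epsilon> \<delta>"
proof
  fix t assume t: "t \<in> inner_set l \<epsilon> \<delta> \<alpha>"
  define x where "x = real \<alpha> / \<epsilon>"
  \<comment> \<open>The least \<open>n\<close> whose rotation budget admits \<alpha> rotations. As
    \<open>x > 1\<close>, it is at least 2, so an \<open>H\<close> fits on each side of the
    gap.\<close>
  define n where "n = nat \<lceil>x\<rceil>"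
  have "real \<alpha> \<ge> 1" using assms(6) by simp
  then have x: "x > 1" "\<epsilon> * x = real \<alpha>"
    using assms(2,3) by (auto simp: x_def field_simps)
  have n: "x \<le> real n" "real n < x + 1" using x(1) unfolding n_def by linarith+
  then obtain k where k: "n = k + 2" using x(1) le_Suc_ex[of 2 n] by fastforce
  let ?w = "H # replicate \<alpha> R @ replicate (Suc k) H"
  have "real \<alpha> \<le> \<epsilon> * real n" using x(2) n(1) assms(2) mult_left_mono[of x n \<epsilon>] by simp
  then have "int \<alpha> \<le> \<lfloor>\<epsilon> * real n\<rfloor>" by (simp add: le_floor_iff)
  then have w: "?w \<in> words \<epsilon> n" by (simp add: words_def count_list_replicate k)
  \<comment> \<open>Rounding \<open>x\<close> up to \<open>n\<close> costs at most one power of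
    \<open>l\<close>, which the extra \<open>- 1\<close> in the exponent of \<open>inner_set\<close>
    covers.\<close>
  have "(1 - \<delta>) * (real n - x) \<le> 1 * 1"
    using n assms(4,5) by (intro mult_mono) auto
  then have e: "real n + (- ((1 - \<delta>) * x) - 1) \<le> \<delta> * real n"
    by (simp add: algebra_simps)
  have "entry_norm (word_mat l t ?w) = l powr real n * \<bar>cos (real \<alpha> * t)\<bar>"
    unfolding entry_norm_single_gap k[symmetric] using assms(1) by (simp add: powr_realpow)
  also have "\<dots> < l powr real n * l powr (- ((1 - \<delta>) * x) - 1)"
    using t assms(1) by (intro mult_strict_left_mono) (auto simp: inner_set_def x_def)
  also have "\<dots> \<le> l powr (\<delta> * real n)"
    unfolding powr_add[symmetric] using e assms(1) by (intro powr_mono) auto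
  finally have "min_word_norm l \<epsilon> n t < l powr (\<delta> * real n)"
    unfolding min_word_norm_less_iff[OF assms(2)] using w by (rule bexI)
  then show "t \<in> resonant_set l \<epsilon> \<delta>"
    using t k by (auto simp: resonant_set_def inner_set_def intro!: exI[of _ n])
qed

lemma resonant_set_subset_outer_sets:
  assumes "l > 1" "0 < \<epsilon>" "\<delta> < 1"
  shows "resonant_set l \<epsilon> \<delta> \<subseteq> (\<Union>\<alpha>\<in>{1..}. outer_set l \<epsilon> \<delta> \<alpha>)"
proof
  fix t assume "t \<in> resonant_set l \<epsilon> \<delta>"
  then obtain n w where t: "t \<in> {0..<2 * pi}" and n: "n \<ge> 1" and w: "w \<in> words \<epsilon> n"
    and less: "entry_norm (word_mat l t w) < l powr (\<delta> * real n)"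
    using assms(2) by (auto simp: resonant_set_def min_word_norm_less_iff)
  show "t \<in> (\<Union>\<alpha>\<in>{1..}. outer_set l \<epsilon> \<delta> \<alpha>)"
  proof (rule ccontr)
    assume not_outer: "t \<notin> (\<Union>\<alpha>\<in>{1..}. outer_set l \<epsilon> \<delta> \<alpha>)"
    \<comment> \<open>The cost per rotation at which the full budget of \<epsilon> \<open>n\<close>
      rotations costs (1 - \<delta>) \<open>n\<close>.\<close>
    define s where "s = (1 - \<delta>) / \<epsilon>"
    have s: "s \<ge> 0" "s * \<epsilon> = 1 - \<delta>" using assms by (auto simp: s_def)
    have cos_ge: "l powr (- (s * real j)) \<le> \<bar>cos (real j * t)\<bar>" for j
    \<comment> \<open>The union starts at 1, but adjacent letters \<open>H\<close> give empty gaps;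
      there both sides equal 1.\<close>
    proof (cases "j = 0")
      case True
      then show ?thesis by simp
    next
      case False
      then have "t \<notin> outer_set l \<epsilon> \<delta> j" using not_outer by auto
      then show ?thesis using t by (auto simp: outer_set_def s_def not_less)
    qed
    have cw: "count_list w H = n" "real (count_list w R) \<le> \<epsilon> * real n"
      using w by (auto simp: words_def le_floor_iff)
    have "s * real (count_list w R) \<le> s * (\<epsilon> * real n)"
      using cw(2) s(1) by (intro mult_left_mono)
    also have "\<dots> = (1 - \<delta>) * real n" using s(2) by (simp flip: mult.assoc)
    finally have "l powr (\<delta> * real n) \<le> l powr (real n - s * real (count_list w R))"
      using assms(1) by (intro powr_mono) (auto simp: algebra_simps)
    also have "\<dots> \<le> entry_norm (word_mat l t w)"
      using entry_norm_word_ge[OF assms(1) s(1) cos_ge, of w] cw(1) n by simp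
    finally show False using less by simp
  qed
qed

theorem theorem2:
  fixes lam \<epsilon> \<delta> :: real
  assumes "lam > 1" and "0 < \<epsilon>" and "\<epsilon> < 1" and "0 < \<delta>" and "\<delta> < 1"
  shows "(\<Union>\<alpha>\<in>{1..}. inner_set lam \<epsilon> \<delta> \<alpha>) \<subseteq> resonant_set lam \<epsilon> \<delta> \<and>
         resonant_set lam \<epsilon> \<delta> \<subseteq> (\<Union>\<alpha>\<in>{1..}. outer_set lam \<epsilon> \<delta> \<alpha>)"
  using inner_set_subset_resonant_set[OF assms] resonant_set_subset_outer_sets[of lam \<epsilon> \<delta>] assms
  by blast

end
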